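(* Let $G$ be a group with a normal subgroup $N\trianglelefteq G$ such that $N$ is hyperlinear and the quotient $G/N$ is amenable. Then $G$ is hyperlinear.
   Context: All groups are discrete groups; no countability or finite generation is assumed. **Normalised Hilbert–Schmidt distance.** Let $\mathcal{U}(\mathbb{C}^n)$ be the group of unitary $n\times n$ complex matrices, $n\geqslant 1$. For $u=(u_{i,j})$, $v=(v_{i,j})\in\mathcal{U}(\mathbb{C}^n)$, put $$d_{HS}(u,v):=\sqrt{\frac1n\sum_{i,j=1}^n|u_{i,j}-v_{i,j}|^2}.$$ **Hyperlinear group.** A group $G$ is hyperlinear if for every finite subset $K\subseteq G$ and every $\varepsilon>0$ there exist a natural number $n\geqslant 1$ and a map $\vartheta\colon G\to\mathcal{U}(\mathbb{C}^n)$ such that: (h1) for all $k_1,k_2\in K$, $d_{HS}\bigl(\vartheta(k_1)\vartheta(k_2),\vartheta(k_1k_2)\bigr)\leqslant\varepsilon$; (h2) for all distinct $k_1,k_2\in K$, $d_{HS}\bigl(\vartheta(k_1),\vartheta(k_2)\bigr)\geqslant\sqrt2-\varepsilon$. **Amenable group.** A group $H$ is amenable if it satisfies the Følner condition: for every finite subset $S\subseteq H$ and every $\varepsilon>0$ there is a non-empty finite subset $F\subseteq H$ with $|F\setminus sF|<\varepsilon|F|$ for all $s\in S$. *)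

theory Defs
  imports
    "HOL-Algebra.Coset"
    "Jordan_Normal_Form.Schur_Decomposition"
begin

definition unitary_mats :: "nat \<Rightarrow> complex mat set" where
  "unitary_mats n =
     {u \<in> carrier_mat n n. u * mat_adjoint u = 1\<^sub>m n \<and> mat_adjoint u * u = 1\<^sub>m n}"

definition hs_dist :: "nat \<Rightarrow> complex mat \<Rightarrow> complex mat \<Rightarrow> real" where
  "hs_dist n u v =
     sqrt (1 / real n * (\<Sum>i<n. \<Sum>j<n. (cmod (u $$ (i, j) - v $$ (i, j)))\<^sup>2))"

definition hyperlinear :: "('a, 'b) monoid_scheme \<Rightarrow> bool" where
  "hyperlinear G \<longleftrightarrow> group G \<and>
     (\<forall>K \<epsilon>. K \<subseteq> carrier G \<and> finite K \<and> \<epsilon> > 0 \<longrightarrow>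
       (\<exists>n \<ge> 1. \<exists>\<theta> \<in> carrier G \<rightarrow> unitary_mats n.
         (\<forall>k1 \<in> K. \<forall>k2 \<in> K. hs_dist n (\<theta> k1 * \<theta> k2) (\<theta> (k1 \<otimes>\<^bsub>G\<^esub> k2)) \<le> \<epsilon>) \<and>
         (\<forall>k1 \<in> K. \<forall>k2 \<in> K. k1 \<noteq> k2 \<longrightarrow> hs_dist n (\<theta> k1) (\<theta> k2) \<ge> sqrt 2 - \<epsilon>)))"

definition amenable :: "('a, 'b) monoid_scheme \<Rightarrow> bool" where
  "amenable H \<longleftrightarrow> group H \<and>
     (\<forall>S (\<epsilon>::real). S \<subseteq> carrier H \<and> finite S \<and> \<epsilon> > 0 \<longrightarrow>
       (\<exists>F. F \<subseteq> carrier H \<and> finite F \<and> F \<noteq> {} \<and>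
         (\<forall>s \<in> S. real (card (F - (s <#\<^bsub>H\<^esub> F))) < \<epsilon> * real (card F))))"

end

theory Submission
  imports Defs
begin

text \<open>
  The proof is a finite-dimensional version of inducing a representation from a normal subgroup.
  Let \<open>h : G \<rightarrow> H\<close> be the quotient map, with kernel \<open>N\<close>, and let \<open>\<sigma>\<close> be a set-theoretic section
  of it. The element \<open>c(g, x) = \<sigma>(h(g) x)\<inverse> g \<sigma>(x)\<close> lies in \<open>N\<close>, satisfies the cocycle identity
  \<open>c(g k, x) = c(g, h(k) x) c(k, x)\<close>, and determines \<open>g\<close> once \<open>x\<close> and \<open>h(g) x\<close> are known
  (lemma \<open>section_cocycle\<close>). A unitary representation \<open>\<theta>\<close> of \<open>N\<close> thus induces one of \<open>G\<close> by block
  monomial matrices: column \<open>x\<close> of the matrix of \<open>g\<close> has the single nonzero block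
  \<open>\<theta>(c(g, x))\<close>, in row \<open>h(g) x\<close>.

  Amenability of \<open>H\<close> makes this finite. The columns are indexed by a finite almost invariant set
  \<open>F \<subseteq> H\<close>, and the translation by \<open>h(g)\<close>, which is only a partial map on \<open>F\<close>, is completed
  arbitrarily to a permutation of \<open>F\<close>. Hyperlinearity of \<open>N\<close> is applied to the finitely many values
  of \<open>c\<close> that occur, after \<open>F\<close> has been chosen.

  The squared normalised Hilbert--Schmidt distance of two block monomial matrices is the average of
  a contribution of each column: the squared distance of the two blocks if they sit in the same
  row, and exactly 2 otherwise (lemma \<open>hs_dist_monomial_mat\<close>). The few columns where a translation
  leaves \<open>F\<close> contribute little. In every other column the cocycle identity gives
  almost multiplicativity; and two distinct elements of \<open>G\<close> have their blocks either in
  different rows, at squared distance 2, or in the same row with different values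
  of \<open>c\<close>, at distance almost \<open>\<surd>2\<close> by the choice of \<open>\<theta>\<close>.
\<close>

section \<open>Unitary matrices and the Hilbert--Schmidt distance\<close>

lemma mat_adjoint_carrier: "u \<in> carrier_mat m n \<Longrightarrow> mat_adjoint u \<in> carrier_mat n m"
  by (intro carrier_matI) (simp_all add: mat_adjoint_def)

lemma mat_adjoint_index:
  fixes u :: "complex mat"
  assumes "u \<in> carrier_mat m n" "i < n" "j < m"
  shows "mat_adjoint u $$ (i, j) = cnj (u $$ (j, i))"
  using assms unfolding mat_adjoint_def by (simp add: mat_of_rows_index)

lemma mult_mat_index_sum:
  assumes "A \<in> carrier_mat k m" "B \<in> carrier_mat m n" "i < k" "j < n"
  shows "(A * B) $$ (i, j) = (\<Sum>l<m. A $$ (i, l) * B $$ (l, j))"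
proof -
  have "(A * B) $$ (i, j) = row A i \<bullet> col B j"
    using assms by simp
  also have "\<dots> = (\<Sum>l<m. row A i $ l * col B j $ l)"
    using assms unfolding scalar_prod_def by (simp add: atLeast0LessThan)
  also have "\<dots> = (\<Sum>l<m. A $$ (i, l) * B $$ (l, j))"
    using assms by (intro sum.cong) simp_all
  finally show ?thesis .
qed

lemma mat_adjoint_mult:
  fixes A B :: "complex mat"
  assumes A: "A \<in> carrier_mat n n" and B: "B \<in> carrier_mat n n"
  shows "mat_adjoint (A * B) = mat_adjoint B * mat_adjoint A"
proof (rule eq_matI)
  note A' = mat_adjoint_carrier[OF A] and B' = mat_adjoint_carrier[OF B]
  note AB = mult_carrier_mat[OF A B]
  fix i j
  assume "i < dim_row (mat_adjoint B * mat_adjoint A)" "j < dim_col (mat_adjoint B * mat_adjoint A)"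
  then have i: "i < n" and j: "j < n" using A' B' by auto
  show "mat_adjoint (A * B) $$ (i, j) = (mat_adjoint B * mat_adjoint A) $$ (i, j)"
    unfolding mat_adjoint_index[OF AB i j] mult_mat_index_sum[OF A B j i]
      mult_mat_index_sum[OF B' A' i j]
    by (auto simp: mat_adjoint_index[OF A _ j] mat_adjoint_index[OF B i] mult.commute intro!: sum.cong)
qed (use mat_adjoint_carrier[OF A] mat_adjoint_carrier[OF B]
      mat_adjoint_carrier[OF mult_carrier_mat[OF A B]] in auto)

lemma unitary_mats_mult:
  assumes u: "u \<in> unitary_mats n" and v: "v \<in> unitary_mats n"
  shows "u * v \<in> unitary_mats n"
proof -
  have U: "u \<in> carrier_mat n n" "v \<in> carrier_mat n n"
    using u v by (auto simp: unitary_mats_def)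
  note U' = U mat_adjoint_carrier[OF U(1)] mat_adjoint_carrier[OF U(2)]
  have "u * v * (mat_adjoint v * mat_adjoint u) = u * (v * mat_adjoint v) * mat_adjoint u"
    using U' by (simp add: assoc_mult_mat[of _ n n _ n _ n])
  moreover have "mat_adjoint v * mat_adjoint u * (u * v) = mat_adjoint v * (mat_adjoint u * u) * v"
    using U' by (simp add: assoc_mult_mat[of _ n n _ n _ n])
  ultimately show ?thesis
    using u v U' by (auto simp: unitary_mats_def mat_adjoint_mult[OF U])
qed

text \<open>
  A one-sided inverse of a square matrix is two-sided, so the column relations alone characterise
  unitarity; for a monomial matrix they can be read off block by block.
\<close>
lemma unitary_mats_iff_orthonormal_columns:
  assumes u: "u \<in> carrier_mat n n"
  shows "u \<in> unitary_mats n \<longleftrightarrow>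
    (\<forall>a<n. \<forall>b<n. (\<Sum>c<n. cnj (u $$ (c, a)) * u $$ (c, b)) = (if a = b then 1 else 0))"
    (is "_ \<longleftrightarrow> ?R")
proof -
  note u' = mat_adjoint_carrier[OF u]
  have entry: "(mat_adjoint u * u) $$ (a, b) = (\<Sum>c<n. cnj (u $$ (c, a)) * u $$ (c, b))"
    if "a < n" "b < n" for a b
    unfolding mult_mat_index_sum[OF u' u that]
    by (auto simp: mat_adjoint_index[OF u that(1)] intro!: sum.cong)
  have "?R \<longleftrightarrow> mat_adjoint u * u = 1\<^sub>m n"
    using u u' by (auto simp: entry[symmetric] mat_eq_iff)
  then show ?thesis
    using mat_mult_left_right_inverse[OF u' u] u by (auto simp: unitary_mats_def)
qed

lemma unitary_mats_sum_norm:
  assumes "u \<in> unitary_mats n"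
  shows "(\<Sum>i<n. \<Sum>j<n. (cmod (u $$ (i, j)))\<^sup>2) = real n"
proof -
  have u: "u \<in> carrier_mat n n" using assms by (auto simp: unitary_mats_def)
  have "(\<Sum>i<n. (cmod (u $$ (i, j)))\<^sup>2) = 1" if "j < n" for j
  proof -
    have "complex_of_real (\<Sum>i<n. (cmod (u $$ (i, j)))\<^sup>2) = (\<Sum>i<n. cnj (u $$ (i, j)) * u $$ (i, j))"
      by (simp add: complex_norm_square mult.commute del: of_real_power)
    also have "\<dots> = 1"
      using assms that unfolding unitary_mats_iff_orthonormal_columns[OF u] by simp
    finally show ?thesis using of_real_eq_1_iff by blast
  qed
  then show ?thesis by (subst sum.swap) simp
qed

lemma hs_dist_nonneg: "hs_dist n u v \<ge> 0"
  by (simp add: hs_dist_def sum_nonneg)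

lemma hs_dist_power2:
  "(hs_dist n u v)\<^sup>2 = 1 / real n * (\<Sum>i<n. \<Sum>j<n. (cmod (u $$ (i, j) - v $$ (i, j)))\<^sup>2)"
  unfolding hs_dist_def by (rule real_sqrt_pow2) (simp add: sum_nonneg)

lemma hs_dist_unitary_le:
  assumes "u \<in> unitary_mats n" "v \<in> unitary_mats n"
  shows "(hs_dist n u v)\<^sup>2 \<le> 4"
proof -
  have "(cmod (a - b))\<^sup>2 \<le> 2 * (cmod a)\<^sup>2 + 2 * (cmod b)\<^sup>2" for a b :: complex
  proof -
    have "(cmod (a - b))\<^sup>2 \<le> (cmod a + cmod b)\<^sup>2"
      by (intro power_mono norm_triangle_ineq4) simp
    also have "\<dots> \<le> 2 * (cmod a)\<^sup>2 + 2 * (cmod b)\<^sup>2"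
      using sum_squares_bound[of "cmod a" "cmod b"] by (simp add: power2_sum)
    finally show ?thesis .
  qed
  then have "(\<Sum>i<n. \<Sum>j<n. (cmod (u $$ (i, j) - v $$ (i, j)))\<^sup>2)
      \<le> (\<Sum>i<n. \<Sum>j<n. 2 * (cmod (u $$ (i, j)))\<^sup>2 + 2 * (cmod (v $$ (i, j)))\<^sup>2)"
    by (intro sum_mono)
  also have "\<dots> = 4 * real n"
    using unitary_mats_sum_norm[OF assms(1)] unitary_mats_sum_norm[OF assms(2)]
    by (simp add: sum.distrib sum_distrib_left[symmetric])
  finally show ?thesis
    unfolding hs_dist_power2 by (cases "n = 0") (auto simp: field_simps)
qed


section \<open>Monomial block matrices\<close>

text \<open>
  The locale labels the matrix indices below \<open>d\<close> by pairs \<open>(x, a)\<close> of a block \<open>x \<in> F\<close> and a position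
  \<open>a < n\<close> inside the block. An abstract bijection turns sums over indices into sums
  over blocks without arithmetic on the indices.
\<close>
locale monomial_blocks =
  fixes F :: "'x set" and n d :: nat and lab :: "nat \<Rightarrow> 'x \<times> nat"
  assumes finite_F: "finite F" and F_nonempty: "F \<noteq> {}" and n_pos: "n \<ge> 1"
    and lab_bij: "bij_betw lab {..<d} (F \<times> {..<n})"
begin

text \<open>
  The matrix of the operator that carries the \<open>x\<close>-th copy of \<open>\<complex>\<^sup>n\<close> to the \<open>p x\<close>-th copy by \<open>U x\<close>:
  an element of the wreath product of the unitary group with the permutations of \<open>F\<close>, when \<open>p\<close> is a
  permutation and all \<open>U x\<close> are unitary.
\<close>
definition monomial_mat :: "('x \<Rightarrow> 'x) \<Rightarrow> ('x \<Rightarrow> complex mat) \<Rightarrow> complex mat" where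
  "monomial_mat p U = mat d d (\<lambda>(i, j).
     if fst (lab i) = p (fst (lab j)) then U (fst (lab j)) $$ (snd (lab i), snd (lab j)) else 0)"

lemma monomial_mat_carrier: "monomial_mat p U \<in> carrier_mat d d"
  by (simp add: monomial_mat_def)

lemma dim_eq: "d = card F * n"
  using bij_betw_same_card[OF lab_bij] by (simp add: card_cartesian_product)

lemma dim_pos: "d \<ge> 1"
  using dim_eq n_pos finite_F F_nonempty by (simp add: Suc_le_eq card_gt_0_iff)

lemma lab_mem: "i < d \<Longrightarrow> fst (lab i) \<in> F" "i < d \<Longrightarrow> snd (lab i) < n"
  using bij_betwE[OF lab_bij] by (force simp: mem_Times_iff)+

lemma sum_lab: "(\<Sum>i<d. f (fst (lab i)) (snd (lab i))) = (\<Sum>x\<in>F. \<Sum>a<n. f x a)"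
  using sum.reindex_bij_betw[OF lab_bij, of "\<lambda>(x, a). f x a"]
  by (simp add: case_prod_beta sum.cartesian_product)

lemma sum_delta_block:
  assumes "y \<in> F"
  shows "(\<Sum>z\<in>F. \<Sum>c<n. if z = y then f z c else 0) = (\<Sum>c<n. f y c)"
proof -
  have "(\<Sum>z\<in>F. \<Sum>c<n. if z = y then f z c else 0) = (\<Sum>z\<in>F. if z = y then \<Sum>c<n. f z c else 0)"
    by (intro sum.cong) auto
  then show ?thesis using assms finite_F by (simp add: sum.delta)
qed

lemma sum_lab_delta:
  assumes "y \<in> F"
  shows "(\<Sum>l<d. if fst (lab l) = y then f (fst (lab l)) (snd (lab l)) else 0) = (\<Sum>c<n. f y c)"
  using trans[OF sum_lab[of "\<lambda>z c. if z = y then f z c else 0"] sum_delta_block[OF assms, of f]] .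

lemma monomial_mat_mult:
  assumes q: "q \<in> F \<rightarrow> F"
    and U: "\<And>x. x \<in> F \<Longrightarrow> U x \<in> carrier_mat n n" and V: "\<And>x. x \<in> F \<Longrightarrow> V x \<in> carrier_mat n n"
  shows "monomial_mat p U * monomial_mat q V = monomial_mat (p \<circ> q) (\<lambda>x. U (q x) * V x)"
proof (rule eq_matI)
  fix i j
  assume "i < dim_row (monomial_mat (p \<circ> q) (\<lambda>x. U (q x) * V x))"
    "j < dim_col (monomial_mat (p \<circ> q) (\<lambda>x. U (q x) * V x))"
  then have i: "i < d" and j: "j < d" by (auto simp: monomial_mat_def)
  obtain y a where ya: "lab i = (y, a)" by force
  obtain x b where xb: "lab j = (x, b)" by force
  have mem: "a < n" "x \<in> F" "b < n" using lab_mem[OF i] lab_mem[OF j] ya xb by auto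
  then have qx: "q x \<in> F" using q by auto
  have "(monomial_mat p U * monomial_mat q V) $$ (i, j)
      = (\<Sum>l<d. monomial_mat p U $$ (i, l) * monomial_mat q V $$ (l, j))"
    by (rule mult_mat_index_sum[OF monomial_mat_carrier monomial_mat_carrier i j])
  also have "\<dots> = (\<Sum>l<d. if fst (lab l) = q x then
       (if y = p (fst (lab l)) then U (fst (lab l)) $$ (a, snd (lab l)) * V x $$ (snd (lab l), b)
        else 0) else 0)"
    using i j ya xb by (intro sum.cong) (auto simp: monomial_mat_def)
  also have "\<dots> = (\<Sum>c<n. if y = p (q x) then U (q x) $$ (a, c) * V x $$ (c, b) else 0)"
    using sum_lab_delta[OF qx, of "\<lambda>z c. if y = p z then U z $$ (a, c) * V x $$ (c, b) else 0"] .
  also have "\<dots> = (if y = p (q x) then (U (q x) * V x) $$ (a, b) else 0)"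
    using mult_mat_index_sum[OF U[OF qx] V[OF mem(2)] mem(1,3)] by simp
  also have "\<dots> = monomial_mat (p \<circ> q) (\<lambda>x. U (q x) * V x) $$ (i, j)"
    using i j ya xb by (simp add: monomial_mat_def)
  finally show "(monomial_mat p U * monomial_mat q V) $$ (i, j)
    = monomial_mat (p \<circ> q) (\<lambda>x. U (q x) * V x) $$ (i, j)" .
qed (simp_all add: monomial_mat_def)

lemma monomial_mat_unitary:
  assumes p: "bij_betw p F F" and U: "\<And>x. x \<in> F \<Longrightarrow> U x \<in> unitary_mats n"
  shows "monomial_mat p U \<in> unitary_mats d"
  unfolding unitary_mats_iff_orthonormal_columns[OF monomial_mat_carrier]
proof (intro allI impI)
  fix i j assume i: "i < d" and j: "j < d"
  obtain y a where ya: "lab i = (y, a)" by force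
  obtain x b where xb: "lab j = (x, b)" by force
  have mem: "y \<in> F" "a < n" "x \<in> F" "b < n" using lab_mem[OF i] lab_mem[OF j] ya xb by auto
  have px: "p x \<in> F" using p mem by (auto dest: bij_betwE)
  have pxy: "p x = p y \<longleftrightarrow> x = y"
    using bij_betw_imp_inj_on[OF p] mem by (auto dest: inj_onD)
  have ij: "i = j \<longleftrightarrow> y = x \<and> a = b"
    using inj_on_eq_iff[OF bij_betw_imp_inj_on[OF lab_bij], of i j] i j ya xb by auto
  have Ux: "U x \<in> carrier_mat n n" using U[OF mem(3)] by (auto simp: unitary_mats_def)
  have "(\<Sum>l<d. cnj (monomial_mat p U $$ (l, i)) * monomial_mat p U $$ (l, j))
      = (\<Sum>l<d. if fst (lab l) = p x then
       (if fst (lab l) = p y then cnj (U y $$ (snd (lab l), a)) * U x $$ (snd (lab l), b)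
        else 0) else 0)"
    using i j ya xb by (intro sum.cong) (auto simp: monomial_mat_def)
  also have "\<dots> = (\<Sum>c<n. if p x = p y then cnj (U y $$ (c, a)) * U x $$ (c, b) else 0)"
    using sum_lab_delta[OF px, of "\<lambda>z c. if z = p y then cnj (U y $$ (c, a)) * U x $$ (c, b) else 0"] .
  also have "\<dots> = (if y = x \<and> a = b then 1 else 0)"
    using U[OF mem(3)] mem pxy unfolding unitary_mats_iff_orthonormal_columns[OF Ux] by auto
  finally show "(\<Sum>l<d. cnj (monomial_mat p U $$ (l, i)) * monomial_mat p U $$ (l, j))
    = (if i = j then 1 else 0)" by (simp only: ij)
qed

text \<open>
  Blocks in different rows are orthogonal, so such a column contributes the sum of the two
  normalised squared norms, each of which is 1 for a unitary block.
\<close>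
lemma hs_dist_monomial_mat:
  assumes p: "p \<in> F \<rightarrow> F" and q: "q \<in> F \<rightarrow> F"
    and U: "\<And>x. x \<in> F \<Longrightarrow> U x \<in> unitary_mats n" and V: "\<And>x. x \<in> F \<Longrightarrow> V x \<in> unitary_mats n"
  shows "(hs_dist d (monomial_mat p U) (monomial_mat q V))\<^sup>2
    = (\<Sum>x\<in>F. if p x = q x then (hs_dist n (U x) (V x))\<^sup>2 else 2) / real (card F)"
proof -
  \<comment> \<open>The squared difference of the two matrices at row label \<open>(y, a)\<close> and column label \<open>(x, b)\<close>.\<close>
  define f where "f x b y a = (cmod ((if y = p x then U x $$ (a, b) else 0)
      - (if y = q x then V x $$ (a, b) else 0)))\<^sup>2" for x b y a
  have block: "(\<Sum>b<n. \<Sum>y\<in>F. \<Sum>a<n. f x b y a)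
      = real n * (if p x = q x then (hs_dist n (U x) (V x))\<^sup>2 else 2)" if x: "x \<in> F" for x
  proof (cases "p x = q x")
    case True
    have qx: "q x \<in> F" using q x by auto
    have "(\<Sum>y\<in>F. \<Sum>a<n. f x b y a) = (\<Sum>a<n. (cmod (U x $$ (a, b) - V x $$ (a, b)))\<^sup>2)" for b
    proof -
      have "(\<Sum>y\<in>F. \<Sum>a<n. f x b y a)
          = (\<Sum>y\<in>F. \<Sum>a<n. if y = q x then (cmod (U x $$ (a, b) - V x $$ (a, b)))\<^sup>2 else 0)"
        by (intro sum.cong) (auto simp: f_def True)
      also have "\<dots> = (\<Sum>a<n. (cmod (U x $$ (a, b) - V x $$ (a, b)))\<^sup>2)"
        by (rule sum_delta_block[OF qx])
      finally show ?thesis .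
    qed
    then have "(\<Sum>b<n. \<Sum>y\<in>F. \<Sum>a<n. f x b y a)
        = (\<Sum>b<n. \<Sum>a<n. (cmod (U x $$ (a, b) - V x $$ (a, b)))\<^sup>2)"
      by (intro sum.cong refl)
    also have "\<dots> = (\<Sum>a<n. \<Sum>b<n. (cmod (U x $$ (a, b) - V x $$ (a, b)))\<^sup>2)"
      by (rule sum.swap)
    also have "\<dots> = real n * (hs_dist n (U x) (V x))\<^sup>2"
      using n_pos by (simp add: hs_dist_power2)
    finally show ?thesis using True by simp
  next
    case False
    have px: "p x \<in> F" and qx: "q x \<in> F" using p q x by auto
    have "(\<Sum>y\<in>F. \<Sum>a<n. f x b y a)
        = (\<Sum>a<n. (cmod (U x $$ (a, b)))\<^sup>2) + (\<Sum>a<n. (cmod (V x $$ (a, b)))\<^sup>2)" for b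
    proof -
      have "(\<Sum>y\<in>F. \<Sum>a<n. f x b y a)
          = (\<Sum>y\<in>F. \<Sum>a<n. if y = p x then (cmod (U x $$ (a, b)))\<^sup>2 else 0)
          + (\<Sum>y\<in>F. \<Sum>a<n. if y = q x then (cmod (V x $$ (a, b)))\<^sup>2 else 0)"
        unfolding sum.distrib[symmetric] using False by (intro sum.cong) (auto simp: f_def)
      also have "\<dots> = (\<Sum>a<n. (cmod (U x $$ (a, b)))\<^sup>2) + (\<Sum>a<n. (cmod (V x $$ (a, b)))\<^sup>2)"
        by (intro arg_cong2[where f = "(+)"] sum_delta_block px qx)
      finally show ?thesis .
    qed
    moreover have "(\<Sum>b<n. \<Sum>a<n. (cmod (W $$ (a, b)))\<^sup>2) = real n" if "W \<in> unitary_mats n" for W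
      using unitary_mats_sum_norm[OF that] by (subst sum.swap)
    ultimately show ?thesis using False U[OF x] V[OF x] by (simp add: sum.distrib)
  qed
  have "(\<Sum>i<d. \<Sum>j<d. (cmod (monomial_mat p U $$ (i, j) - monomial_mat q V $$ (i, j)))\<^sup>2)
      = (\<Sum>j<d. \<Sum>i<d. f (fst (lab j)) (snd (lab j)) (fst (lab i)) (snd (lab i)))"
    by (subst sum.swap, intro sum.cong) (auto simp: monomial_mat_def f_def)
  also have "\<dots> = (\<Sum>j<d. (\<lambda>x b. \<Sum>y\<in>F. \<Sum>a<n. f x b y a) (fst (lab j)) (snd (lab j)))"
    by (intro sum.cong refl sum_lab)
  also have "\<dots> = (\<Sum>x\<in>F. \<Sum>b<n. \<Sum>y\<in>F. \<Sum>a<n. f x b y a)"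
    by (rule sum_lab)
  also have "\<dots> = real n * (\<Sum>x\<in>F. if p x = q x then (hs_dist n (U x) (V x))\<^sup>2 else 2)"
    unfolding sum_distrib_left by (intro sum.cong refl block)
  finally show ?thesis
    unfolding hs_dist_power2 using n_pos by (simp add: dim_eq)
qed

text \<open>
  In the next two lemmas \<open>B\<close> collects the bad columns, about which nothing is known. For the upper
  bound each of them costs at most 4, the largest squared distance between unitaries.
\<close>
lemma hs_dist_monomial_mat_le:
  assumes p: "p \<in> F \<rightarrow> F" and q: "q \<in> F \<rightarrow> F"
    and U: "\<And>x. x \<in> F \<Longrightarrow> U x \<in> unitary_mats n" and V: "\<And>x. x \<in> F \<Longrightarrow> V x \<in> unitary_mats n"
    and bad: "real (card B) \<le> \<delta> * real (card F)" "B \<subseteq> F"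
    and good: "\<And>x. x \<in> F - B \<Longrightarrow> p x = q x \<and> hs_dist n (U x) (V x) \<le> e"
  shows "(hs_dist d (monomial_mat p U) (monomial_mat q V))\<^sup>2 \<le> e\<^sup>2 + 4 * \<delta>"
proof -
  have pos: "real (card F) > 0" using finite_F F_nonempty by (simp add: card_gt_0_iff)
  have "(\<Sum>x\<in>F. if p x = q x then (hs_dist n (U x) (V x))\<^sup>2 else 2)
      \<le> (\<Sum>x\<in>F. e\<^sup>2 + (if x \<in> B then 4 else 0))"
  proof (rule sum_mono)
    fix x assume x: "x \<in> F"
    have "(hs_dist n (U x) (V x))\<^sup>2 \<le> e\<^sup>2" if "x \<notin> B"
      using good[of x] x that hs_dist_nonneg by (intro power_mono) auto
    moreover have "(hs_dist n (U x) (V x))\<^sup>2 \<le> e\<^sup>2 + 4"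
      using hs_dist_unitary_le[OF U[OF x] V[OF x]] zero_le_power2[of e] by linarith
    moreover have "(2::real) \<le> e\<^sup>2 + 4" using zero_le_power2[of e] by linarith
    ultimately show "(if p x = q x then (hs_dist n (U x) (V x))\<^sup>2 else 2)
        \<le> e\<^sup>2 + (if x \<in> B then 4 else 0)"
      using good[of x] x by auto
  qed
  also have "\<dots> = e\<^sup>2 * real (card F) + 4 * real (card B)"
    using bad(2) finite_F by (simp add: sum.distrib sum.If_cases Int_absorb1)
  also have "\<dots> \<le> (e\<^sup>2 + 4 * \<delta>) * real (card F)"
    using bad(1) by (simp add: algebra_simps)
  finally have "(\<Sum>x\<in>F. if p x = q x then (hs_dist n (U x) (V x))\<^sup>2 else 2) / real (card F)
      \<le> e\<^sup>2 + 4 * \<delta>"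
    using pos by (simp only: pos_divide_le_eq pos_le_divide_eq)
  moreover have "(hs_dist d (monomial_mat p U) (monomial_mat q V))\<^sup>2
      = (\<Sum>x\<in>F. if p x = q x then (hs_dist n (U x) (V x))\<^sup>2 else 2) / real (card F)"
    by (rule hs_dist_monomial_mat[OF p q]) (simp_all add: U V)
  ultimately show ?thesis by simp
qed

text \<open>
  For the lower bound the bad columns are discarded. The assumption \<open>r \<le> \<surd>2\<close> makes the columns whose
  blocks sit in different rows as good as the others.
\<close>
lemma hs_dist_monomial_mat_ge:
  assumes p: "p \<in> F \<rightarrow> F" and q: "q \<in> F \<rightarrow> F"
    and U: "\<And>x. x \<in> F \<Longrightarrow> U x \<in> unitary_mats n" and V: "\<And>x. x \<in> F \<Longrightarrow> V x \<in> unitary_mats n"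
    and bad: "real (card B) \<le> \<delta> * real (card F)" "B \<subseteq> F"
    and r: "0 \<le> r" "r \<le> sqrt 2"
    and good: "\<And>x. x \<in> F - B \<Longrightarrow> p x = q x \<Longrightarrow> r \<le> hs_dist n (U x) (V x)"
  shows "(1 - \<delta>) * r\<^sup>2 \<le> (hs_dist d (monomial_mat p U) (monomial_mat q V))\<^sup>2"
proof -
  have pos: "real (card F) > 0" using finite_F F_nonempty by (simp add: card_gt_0_iff)
  have r2: "r\<^sup>2 \<le> 2" using power_mono[OF r(2,1), of 2] by simp
  have "(1 - \<delta>) * r\<^sup>2 * real (card F) = r\<^sup>2 * (real (card F) - \<delta> * real (card F))"
    by (simp add: algebra_simps)
  also have "\<dots> \<le> r\<^sup>2 * (real (card F) - real (card B))"
    using bad(1) by (intro mult_left_mono) auto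
  also have "\<dots> = (\<Sum>x\<in>F. r\<^sup>2 - (if x \<in> B then r\<^sup>2 else 0))"
    using bad(2) finite_F by (simp add: sum_subtractf sum.If_cases Int_absorb1 algebra_simps)
  also have "\<dots> \<le> (\<Sum>x\<in>F. if p x = q x then (hs_dist n (U x) (V x))\<^sup>2 else 2)"
    using good r(1) r2 by (intro sum_mono) (auto intro: power_mono)
  finally have "(\<Sum>x\<in>F. if p x = q x then (hs_dist n (U x) (V x))\<^sup>2 else 2) / real (card F)
      \<ge> (1 - \<delta>) * r\<^sup>2"
    using pos by (simp only: pos_divide_le_eq pos_le_divide_eq)
  moreover have "(hs_dist d (monomial_mat p U) (monomial_mat q V))\<^sup>2
      = (\<Sum>x\<in>F. if p x = q x then (hs_dist n (U x) (V x))\<^sup>2 else 2) / real (card F)"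
    by (rule hs_dist_monomial_mat[OF p q]) (simp_all add: U V)
  ultimately show ?thesis by simp
qed

end

lemma ex_monomial_blocks:
  assumes "finite F" "F \<noteq> {}" "n \<ge> 1"
  shows "\<exists>d lab. monomial_blocks F n d lab"
  using ex_bij_betw_nat_finite[of "F \<times> {..<n}"] assms
  by (auto simp: monomial_blocks_def atLeast0LessThan)


section \<open>Extensions of hyperlinear groups by amenable groups\<close>

text \<open>
  The points of \<open>A\<close> sent outside \<open>A\<close> are as many as the points of \<open>A\<close> that are not hit, so any
  bijection between these two sets completes the partial map.
\<close>
lemma partial_injection_extends_to_permutation:
  assumes A: "finite A" and f: "inj_on f A"
  shows "\<exists>p. bij_betw p A A \<and> (\<forall>x\<in>A. f x \<in> A \<longrightarrow> p x = f x)"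
proof -
  define B where "B = {x \<in> A. f x \<in> A}"
  have B: "B \<subseteq> A" "f ` B \<subseteq> A" and inj: "inj_on f B"
    using f by (auto simp: B_def inj_on_def)
  have "card (A - B) = card (A - f ` B)"
    using A B card_image[OF inj] by (simp add: card_Diff_subset finite_subset)
  then obtain h where h: "bij_betw h (A - B) (A - f ` B)"
    using A finite_same_card_bij[of "A - B" "A - f ` B"] by auto
  let ?p = "\<lambda>x. if x \<in> B then f x else h x"
  have "bij_betw ?p (B \<union> (A - B)) (f ` B \<union> (A - f ` B))"
    using inj_on_imp_bij_betw[OF inj] h by (intro bij_betw_disjoint_Un) auto
  then have "bij_betw ?p A A" using B by (simp add: Un_absorb1)
  then show ?thesis by (intro exI[of _ ?p]) (auto simp: B_def)
qed

text \<open>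
  The form of the Folner condition that counts the points leaving \<open>F\<close>: \<open>s x \<notin> F\<close> means
  \<open>x \<notin> s\<inverse> F\<close>, so the condition is applied to the inverses of the elements of \<open>S\<close>.
\<close>
lemma amenable_almost_invariant:
  assumes "amenable H" "S \<subseteq> carrier H" "finite S" "(\<epsilon>::real) > 0"
  obtains F where "F \<subseteq> carrier H" "finite F" "F \<noteq> {}"
    "\<forall>s\<in>S. real (card {x \<in> F. s \<otimes>\<^bsub>H\<^esub> x \<notin> F}) \<le> \<epsilon> * real (card F)"
proof -
  interpret H: group H using assms(1) by (simp add: amenable_def)
  have "(\<lambda>s. inv\<^bsub>H\<^esub> s) ` S \<subseteq> carrier H" using assms(2) by auto
  then obtain F where F: "F \<subseteq> carrier H" "finite F" "F \<noteq> {}"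
    and inv: "\<And>s. s \<in> S \<Longrightarrow> real (card (F - (inv\<^bsub>H\<^esub> s <#\<^bsub>H\<^esub> F))) < \<epsilon> * real (card F)"
    using assms unfolding amenable_def by (metis finite_imageI image_eqI)
  have "{x \<in> F. s \<otimes>\<^bsub>H\<^esub> x \<notin> F} \<subseteq> F - (inv\<^bsub>H\<^esub> s <#\<^bsub>H\<^esub> F)" if "s \<in> S" for s
  proof -
    have s: "s \<in> carrier H" using that assms(2) by auto
    have "s \<otimes>\<^bsub>H\<^esub> (inv\<^bsub>H\<^esub> s \<otimes>\<^bsub>H\<^esub> y) = y" if "y \<in> F" for y
      using that F(1) s by (simp add: H.m_assoc[symmetric] subset_iff)
    then show ?thesis by (auto simp: l_coset_def)
  qed
  then have "real (card {x \<in> F. s \<otimes>\<^bsub>H\<^esub> x \<notin> F}) \<le> \<epsilon> * real (card F)" if "s \<in> S" for s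
    using inv[OF that] F(2) that card_mono[of "F - (inv\<^bsub>H\<^esub> s <#\<^bsub>H\<^esub> F)" "{x \<in> F. s \<otimes>\<^bsub>H\<^esub> x \<notin> F}"]
    by fastforce
  with F show thesis using that by blast
qed

text \<open>
  The section \<open>\<sigma>\<close> identifies \<open>G\<close> with \<open>H \<times> kernel G H h\<close> as a set, by \<open>(x, m) \<mapsto> \<sigma> x \<otimes> m\<close>. Left
  multiplication by \<open>g\<close> then becomes \<open>(x, m) \<mapsto> (h g \<otimes> x, c g x \<otimes> m)\<close>; the cocycle identity says
  that this is an action.
\<close>
lemma (in group_hom) section_cocycle:
  assumes \<sigma>: "\<forall>x\<in>carrier H. \<sigma> x \<in> carrier G \<and> h (\<sigma> x) = x"
  defines "c \<equiv> \<lambda>g x. inv (\<sigma> (h g \<otimes>\<^bsub>H\<^esub> x)) \<otimes> (g \<otimes> \<sigma> x)"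
  shows cocycle_kernel: "\<lbrakk>g \<in> carrier G; x \<in> carrier H\<rbrakk> \<Longrightarrow> c g x \<in> kernel G H h"
    and cocycle_mult: "\<lbrakk>g \<in> carrier G; k \<in> carrier G; x \<in> carrier H\<rbrakk> \<Longrightarrow>
      c (g \<otimes> k) x = c g (h k \<otimes>\<^bsub>H\<^esub> x) \<otimes> c k x"
    and cocycle_inj: "\<lbrakk>g \<in> carrier G; k \<in> carrier G; x \<in> carrier H;
      h g \<otimes>\<^bsub>H\<^esub> x = h k \<otimes>\<^bsub>H\<^esub> x; c g x = c k x\<rbrakk> \<Longrightarrow> g = k"
proof -
  have \<sigma>1: "\<sigma> x \<in> carrier G" and \<sigma>2: "h (\<sigma> x) = x" if "x \<in> carrier H" for x
    using \<sigma> that by auto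
  show "c g x \<in> kernel G H h" if "g \<in> carrier G" "x \<in> carrier H"
    using that by (simp add: c_def kernel_def \<sigma>1 \<sigma>2)
  show "c (g \<otimes> k) x = c g (h k \<otimes>\<^bsub>H\<^esub> x) \<otimes> c k x"
    if "g \<in> carrier G" "k \<in> carrier G" "x \<in> carrier H"
  proof -
    let ?t = "\<sigma> (h k \<otimes>\<^bsub>H\<^esub> x)"
    have "?t \<otimes> (inv ?t \<otimes> (k \<otimes> \<sigma> x)) = k \<otimes> \<sigma> x"
      using that by (simp add: G.m_assoc[symmetric] \<sigma>1)
    then show ?thesis
      using that by (simp add: c_def \<sigma>1 G.m_assoc H.m_assoc)
  qed
  show "g = k" if "g \<in> carrier G" "k \<in> carrier G" "x \<in> carrier H"
    "h g \<otimes>\<^bsub>H\<^esub> x = h k \<otimes>\<^bsub>H\<^esub> x" "c g x = c k x"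
    using that by (simp add: c_def \<sigma>1)
qed

lemma (in group_hom) hyperlinear_if_kernel_hyperlinear_image_amenable:
  assumes surj: "h ` carrier G = carrier H"
    and hyp: "hyperlinear (G\<lparr>carrier := kernel G H h\<rparr>)"
    and am: "amenable H"
  shows "hyperlinear G"
  unfolding hyperlinear_def
proof (intro conjI allI impI)
  show "group G" by (rule G.is_group)
next
  fix K and \<epsilon> :: real
  assume "K \<subseteq> carrier G \<and> finite K \<and> \<epsilon> > 0"
  then have K: "K \<subseteq> carrier G" "finite K" and \<epsilon>: "\<epsilon> > 0" by auto
  \<comment> \<open>The products belong to \<open>L\<close> because multiplicativity compares the columns of \<open>g \<otimes> k\<close> as well.\<close>
  define L where "L = K \<union> (\<lambda>(g, k). g \<otimes> k) ` (K \<times> K)"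
  have L: "L \<subseteq> carrier G" "finite L" and KL: "K \<subseteq> L"
    and KKL: "\<And>g k. g \<in> K \<Longrightarrow> k \<in> K \<Longrightarrow> g \<otimes> k \<in> L"
    using K by (auto simp: L_def)
  \<comment> \<open>Each comparison involves at most two translations, so a fraction \<open>2 * \<eta>\<close> of the columns is bad.
    The two bounds in the minimum serve separation and multiplicativity, respectively.\<close>
  define \<eta> where "\<eta> = min (\<epsilon> / 8) (\<epsilon>\<^sup>2 / 16)"
  have \<eta>: "\<eta> > 0" "2 * \<eta> \<le> \<epsilon> / 4" "4 * (2 * \<eta>) \<le> \<epsilon>\<^sup>2 / 2" using \<epsilon> by (auto simp: \<eta>_def)
  have hL: "h ` L \<subseteq> carrier H" "finite (h ` L)" using L by auto
  obtain F where F: "F \<subseteq> carrier H" "finite F" "F \<noteq> {}"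
    and Folner: "\<forall>s\<in>h ` L. real (card {x \<in> F. s \<otimes>\<^bsub>H\<^esub> x \<notin> F}) \<le> \<eta> * real (card F)"
    by (rule amenable_almost_invariant[OF am hL \<eta>(1)])
  define B where "B g = {x \<in> F. h g \<otimes>\<^bsub>H\<^esub> x \<notin> F}" for g
  have bad: "real (card (B g \<union> B k)) \<le> 2 * \<eta> * real (card F)" "B g \<union> B k \<subseteq> F"
    if "g \<in> L" "k \<in> L" for g k
  proof -
    have "card (B g \<union> B k) \<le> card (B g) + card (B k)" by (rule card_Un_le)
    then show "real (card (B g \<union> B k)) \<le> 2 * \<eta> * real (card F)"
      using bspec[OF Folner, of "h g"] bspec[OF Folner, of "h k"] that by (simp add: B_def)
  qed (auto simp: B_def)
  have "\<forall>x\<in>carrier H. \<exists>y. y \<in> carrier G \<and> h y = x" using surj by (metis imageE)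
  then obtain \<sigma> where \<sigma>: "\<forall>x\<in>carrier H. \<sigma> x \<in> carrier G \<and> h (\<sigma> x) = x" by metis
  define c where "c g x = inv (\<sigma> (h g \<otimes>\<^bsub>H\<^esub> x)) \<otimes> (g \<otimes> \<sigma> x)" for g x
  note c_kernel = cocycle_kernel[OF \<sigma>, folded c_def]
    and c_mult = cocycle_mult[OF \<sigma>, folded c_def]
    and c_inj = cocycle_inj[OF \<sigma>, folded c_def]
  \<comment> \<open>Only finitely many elements of the kernel appear as blocks.\<close>
  define K' where "K' = (\<lambda>(g, x). c g x) ` (L \<times> F)"
  have K': "K' \<subseteq> kernel G H h" "finite K'" and cK': "\<And>g x. g \<in> L \<Longrightarrow> x \<in> F \<Longrightarrow> c g x \<in> K'"
    using L F c_kernel by (auto simp: K'_def)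
  obtain n \<theta> where n: "n \<ge> 1" and \<theta>: "\<theta> \<in> kernel G H h \<rightarrow> unitary_mats n"
    and \<theta>_mult: "\<And>k1 k2. k1 \<in> K' \<Longrightarrow> k2 \<in> K' \<Longrightarrow> hs_dist n (\<theta> k1 * \<theta> k2) (\<theta> (k1 \<otimes> k2)) \<le> \<epsilon> / 2"
    and \<theta>_sep: "\<And>k1 k2. k1 \<in> K' \<Longrightarrow> k2 \<in> K' \<Longrightarrow> k1 \<noteq> k2 \<Longrightarrow>
      hs_dist n (\<theta> k1) (\<theta> k2) \<ge> sqrt 2 - \<epsilon> / 2"
    using hyp[unfolded hyperlinear_def, THEN conjunct2, rule_format, of K' "\<epsilon> / 2"] K' \<epsilon> by auto
  have "\<exists>p. bij_betw p F F \<and> (\<forall>x\<in>F. h g \<otimes>\<^bsub>H\<^esub> x \<in> F \<longrightarrow> p x = h g \<otimes>\<^bsub>H\<^esub> x)"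
    if "g \<in> carrier G" for g
    using that F by (intro partial_injection_extends_to_permutation) (auto simp: inj_on_def subset_iff)
  then obtain p where p: "\<And>g. g \<in> carrier G \<Longrightarrow> bij_betw (p g) F F"
    and p_eq: "\<And>g x. g \<in> carrier G \<Longrightarrow> x \<in> F \<Longrightarrow> x \<notin> B g \<Longrightarrow> p g x = h g \<otimes>\<^bsub>H\<^esub> x"
    unfolding B_def by (metis (mono_tags, lifting) mem_Collect_eq)
  have pF: "p g \<in> F \<rightarrow> F" if "g \<in> carrier G" for g using p[OF that] by (auto dest: bij_betwE)
  have U: "\<theta> (c g x) \<in> unitary_mats n" if "g \<in> carrier G" "x \<in> F" for g x
    using \<theta> c_kernel that F by auto
  obtain d lab where "monomial_blocks F n d lab" using ex_monomial_blocks F n by blast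
  then interpret monomial_blocks F n d lab .
  define \<Theta> where "\<Theta> g = monomial_mat (p g) (\<lambda>x. \<theta> (c g x))" for g
  have "\<Theta> \<in> carrier G \<rightarrow> unitary_mats d"
    unfolding \<Theta>_def using p U by (auto intro: monomial_mat_unitary)
  moreover have "hs_dist d (\<Theta> g * \<Theta> k) (\<Theta> (g \<otimes> k)) \<le> \<epsilon>" if gk: "g \<in> K" "k \<in> K" for g k
  proof -
    have g: "g \<in> carrier G" "g \<in> L" and k: "k \<in> carrier G" "k \<in> L"
      and gkL: "g \<otimes> k \<in> carrier G" "g \<otimes> k \<in> L"
      using gk K KL KKL by auto
    have "\<Theta> g * \<Theta> k = monomial_mat (p g \<circ> p k) (\<lambda>x. \<theta> (c g (p k x)) * \<theta> (c k x))"
      unfolding \<Theta>_def using U g k pF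
      by (intro monomial_mat_mult) (auto simp: unitary_mats_def)
    moreover have "(hs_dist d (monomial_mat (p g \<circ> p k) (\<lambda>x. \<theta> (c g (p k x)) * \<theta> (c k x)))
        (\<Theta> (g \<otimes> k)))\<^sup>2 \<le> (\<epsilon> / 2)\<^sup>2 + 4 * (2 * \<eta>)"
      unfolding \<Theta>_def
    proof (rule hs_dist_monomial_mat_le[OF _ pF[OF gkL(1)] _ _ bad[OF k(2) gkL(2)]])
      show "p g \<circ> p k \<in> F \<rightarrow> F" using pF[OF g(1)] pF[OF k(1)] by auto
      show "\<theta> (c g (p k x)) * \<theta> (c k x) \<in> unitary_mats n" if "x \<in> F" for x
        using U g k pF that by (intro unitary_mats_mult) auto
      show "\<theta> (c (g \<otimes> k) x) \<in> unitary_mats n" if "x \<in> F" for x using U[OF gkL(1) that] .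
      fix x assume x: "x \<in> F - (B k \<union> B (g \<otimes> k))"
      let ?y = "h k \<otimes>\<^bsub>H\<^esub> x"
      have xH: "x \<in> carrier H" using x F by auto
      have y: "?y \<in> F" "p k x = ?y" using x p_eq[OF k(1)] by (auto simp: B_def)
      have gy: "h g \<otimes>\<^bsub>H\<^esub> ?y = h (g \<otimes> k) \<otimes>\<^bsub>H\<^esub> x"
        using g(1) k(1) xH by (simp add: H.m_assoc)
      then have "h g \<otimes>\<^bsub>H\<^esub> ?y \<in> F" using x by (auto simp: B_def)
      then have "p g ?y = p (g \<otimes> k) x"
        using gy y x p_eq[OF g(1), of ?y] p_eq[OF gkL(1), of x] by (auto simp: B_def)
      then show "(p g \<circ> p k) x = p (g \<otimes> k) x \<and>
          hs_dist n (\<theta> (c g (p k x)) * \<theta> (c k x)) (\<theta> (c (g \<otimes> k) x)) \<le> \<epsilon> / 2"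
        using \<theta>_mult[OF cK'[OF g(2) y(1)] cK'[OF k(2)], of x] x y c_mult[OF g(1) k(1) xH] by simp
    qed
    ultimately have "(hs_dist d (\<Theta> g * \<Theta> k) (\<Theta> (g \<otimes> k)))\<^sup>2 \<le> (\<epsilon> / 2)\<^sup>2 + \<epsilon>\<^sup>2 / 2"
      using \<eta>(3) by simp
    also have "\<dots> \<le> \<epsilon>\<^sup>2" by (simp add: power_divide)
    finally show ?thesis by (rule power2_le_imp_le) (use \<epsilon> in simp)
  qed
  moreover have "hs_dist d (\<Theta> g) (\<Theta> k) \<ge> sqrt 2 - \<epsilon>" if gk: "g \<in> K" "k \<in> K" "g \<noteq> k" for g k
  proof (cases "\<epsilon> \<ge> sqrt 2")
    case True
    then show ?thesis using hs_dist_nonneg[of d "\<Theta> g" "\<Theta> k"] by linarith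
  next
    case False
    have g: "g \<in> carrier G" "g \<in> L" and k: "k \<in> carrier G" "k \<in> L"
      using gk K KL by auto
    define r where "r = sqrt 2 - \<epsilon> / 2"
    have r: "0 \<le> r" "r \<le> sqrt 2" using False \<epsilon> by (auto simp: r_def)
    have "(1 - 2 * \<eta>) * r\<^sup>2 \<le> (hs_dist d (\<Theta> g) (\<Theta> k))\<^sup>2"
      unfolding \<Theta>_def
    proof (rule hs_dist_monomial_mat_ge[OF pF[OF g(1)] pF[OF k(1)] U[OF g(1)] U[OF k(1)]
          bad[OF g(2) k(2)] r])
      fix x assume x: "x \<in> F - (B g \<union> B k)" and eq: "p g x = p k x"
      then have "h g \<otimes>\<^bsub>H\<^esub> x = h k \<otimes>\<^bsub>H\<^esub> x" using p_eq[OF g(1)] p_eq[OF k(1)] by auto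
      then have "c g x \<noteq> c k x" using c_inj[OF g(1) k(1)] gk(3) x F by blast
      then show "r \<le> hs_dist n (\<theta> (c g x)) (\<theta> (c k x))"
        unfolding r_def using \<theta>_sep cK' g k x by simp
    qed
    \<comment> \<open>Squaring \<open>1 - 2 * \<eta>\<close>, which lies in \<open>[0, 1]\<close>, avoids its square root in the final bound.\<close>
    moreover have "((1 - 2 * \<eta>) * r)\<^sup>2 \<le> (1 - 2 * \<eta>) * r\<^sup>2"
    proof -
      have "sqrt 2 \<le> 2" by (rule real_le_lsqrt) auto
      then have "0 \<le> 1 - 2 * \<eta>" "1 - 2 * \<eta> \<le> 1" using \<eta> False by auto
      then have "(1 - 2 * \<eta>) * (1 - 2 * \<eta>) \<le> 1 - 2 * \<eta>" by (simp add: mult_left_le)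
      then show ?thesis
        by (simp add: power_mult_distrib power2_eq_square[of "1 - 2 * \<eta>"] mult_right_mono)
    qed
    ultimately have "(1 - 2 * \<eta>) * r \<le> hs_dist d (\<Theta> g) (\<Theta> k)"
      using hs_dist_nonneg by (intro power2_le_imp_le[of "(1 - 2 * \<eta>) * r"]) auto
    moreover have "2 * \<eta> * r \<le> \<epsilon> / 4 * 2"
    proof (intro mult_mono \<eta>)
      have "sqrt 2 \<le> 2" by (rule real_le_lsqrt) auto
      then show "r \<le> 2" using r by simp
    qed (use r \<epsilon> in auto)
    ultimately show ?thesis by (simp add: r_def left_diff_distrib)
  qed
  ultimately show "\<exists>n\<ge>1. \<exists>\<theta>\<in>carrier G \<rightarrow> unitary_mats n.
      (\<forall>k1\<in>K. \<forall>k2\<in>K. hs_dist n (\<theta> k1 * \<theta> k2) (\<theta> (k1 \<otimes> k2)) \<le> \<epsilon>) \<and>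
      (\<forall>k1\<in>K. \<forall>k2\<in>K. k1 \<noteq> k2 \<longrightarrow> sqrt 2 - \<epsilon> \<le> hs_dist n (\<theta> k1) (\<theta> k2))"
    using dim_pos by blast
qed

theorem corollary1p1:
  fixes G :: "('a, 'b) monoid_scheme" and N :: "'a set"
  assumes "group G"
    and "N \<lhd> G"
    and "hyperlinear (G\<lparr>carrier := N\<rparr>)"
    and "amenable (G Mod N)"
  shows "hyperlinear G"
proof -
  interpret normal N G by (rule assms(2))
  interpret quot: group_hom G "G Mod N" "\<lambda>g. N #>\<^bsub>G\<^esub> g"
    by (simp add: group_hom_def group_hom_axioms_def assms(1) factorgroup_is_group r_coset_hom_Mod)
  have "kernel G (G Mod N) (\<lambda>g. N #>\<^bsub>G\<^esub> g) = N"
    using coset_join1[OF _ _ subgroup_axioms] coset_join2[OF _ subgroup_axioms] subset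
    by (auto simp: kernel_def)
  then show ?thesis
    using quot.hyperlinear_if_kernel_hyperlinear_image_amenable assms(3,4)
    by (simp add: carrier_FactGroup)
qed

end
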